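(* Let $\kappa$ be an infinite cardinal. The following are equivalent: (1) $\kappa<\mathfrak{b}$; (2) each subset of $\mathbb{N}^{\mathbb{N}\nearrow}$ of cardinality $\kappa$ admits a slalom; (3) for each family $Y\subseteq P_\infty(\mathbb{N})$ of cardinality $\kappa$, there exists a partition $\{F_n\}_{n\in\mathbb{N}}$ of $\mathbb{N}$ into finite sets such that for each $y\in Y$, $y\cap F_n\neq\emptyset$ for all but finitely many $n$; (4) every countable large cover of $\kappa$ is groupable.
   Context: $\mathbb{N}=\{0,1,2,\dots\}$. For $f,g\in\mathbb{N}^{\mathbb{N}}$, $f\le^* g$ means $f(n)\le g(n)$ for all but finitely many $n$. A subset $Y\subseteq\mathbb{N}^{\mathbb{N}}$ is bounded if there is $g\in\mathbb{N}^{\mathbb{N}}$ with $f\le^* g$ for all $f\in Y$, and unbounded otherwise; $\mathfrak{b}$ is the minimal cardinality of an unbounded subset of $\mathbb{N}^{\mathbb{N}}$. $\mathbb{N}^{\mathbb{N}\nearrow}$ is the set of strictly increasing elements of $\mathbb{N}^{\mathbb{N}}$, and $P_\infty(\mathbb{N})$ is the set of infinite subsets of $\mathbb{N}$. A set $Y\subseteq\mathbb{N}^{\mathbb{N}\nearrow}$ admits a slalom if there exists $g\in\mathbb{N}^{\mathbb{N}\nearrow}$ such that for each $f\in Y$, for all but finitely many $n$ there exists $m$ with $f(m)\in[g(n),g(n+1))$. In (4), $\kappa$ is regarded as a set with no topology, and covers are by arbitrary subsets of $\kappa$. A family $\mathcal{U}$ is a large cover of a set $X$ if each $x\in X$ is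 contained in infinitely many members of $\mathcal{U}$. A large cover $\mathcal{U}$ of $X$ is groupable if there exists a partition $\mathcal{P}$ of $\mathcal{U}$ into finite sets such that for each $x\in X$, $x\in\bigcup\mathcal{F}$ for all but finitely many $\mathcal{F}\in\mathcal{P}$.
   Formalization: For κ > 2^ℵ0, (2) and (3) hold vacuously while (1) fails; so (2) and (3) with cardinality exactly κ are proved equivalent to (1) for κ ≤ 2^ℵ0, and for every infinite κ with "at most κ" in place of "κ". *)

theory Defs
  imports Main "HOL-Library.Infinite_Set" "HOL-Library.Countable_Set" "HOL-Library.Disjoint_Sets"
begin

unbundle cardinal_syntax

definition le_star :: "(nat \<Rightarrow> nat) \<Rightarrow> (nat \<Rightarrow> nat) \<Rightarrow> bool"  (infix "\<le>\<^sup>*" 50)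
  where "f \<le>\<^sup>* g \<longleftrightarrow> (\<forall>\<^sub>\<infinity>n. f n \<le> g n)"

definition star_bounded :: "(nat \<Rightarrow> nat) set \<Rightarrow> bool"
  where "star_bounded Y \<longleftrightarrow> (\<exists>g. \<forall>f\<in>Y. f \<le>\<^sup>* g)"

definition unbounded_cards :: "(nat \<Rightarrow> nat) rel set"
  where "unbounded_cards = {|Y| |Y. \<not> star_bounded Y}"

text \<open>
  The library represents cardinals by well-order relations, unique only up to \<open>=o\<close>; hence a
  choice among the representatives of the minimum. The minimum exists by \<open>bfrak_least\<close> below.
\<close>
definition bfrak :: "(nat \<Rightarrow> nat) rel"
  where "bfrak = (SOME r. r \<in> unbounded_cards \<and> (\<forall>s\<in>unbounded_cards. r \<le>o s))"

definition admits_slalom :: "(nat \<Rightarrow> nat) set \<Rightarrow> bool"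
  where "admits_slalom Y \<longleftrightarrow>
    (\<exists>g. strict_mono g \<and> (\<forall>f\<in>Y. \<forall>\<^sub>\<infinity>n. \<exists>m. f m \<in> {g n..<g (Suc n)}))"

definition finite_partition_seq :: "(nat \<Rightarrow> nat set) \<Rightarrow> bool"
  where "finite_partition_seq F \<longleftrightarrow>
    disjoint_family F \<and> partition_on UNIV (range F) \<and> (\<forall>n. finite (F n))"

definition large_cover :: "'a set \<Rightarrow> 'a set set \<Rightarrow> bool"
  where "large_cover X \<U> \<longleftrightarrow> \<U> \<subseteq> Pow X \<and> (\<forall>x\<in>X. infinite {U \<in> \<U>. x \<in> U})"

definition groupable :: "'a set \<Rightarrow> 'a set set \<Rightarrow> bool"
  where "groupable X \<U> \<longleftrightarrow>
    (\<exists>\<P>. partition_on \<U> \<P> \<and> (\<forall>\<F>\<in>\<P>. finite \<F>) \<and> (\<forall>x\<in>X. finite {\<F> \<in> \<P>. x \<notin> \<Union>\<F>}))"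

lemma not_star_bounded_UNIV: "\<not> star_bounded UNIV"
proof
  assume "star_bounded UNIV"
  then obtain g where "\<forall>f. f \<le>\<^sup>* g"
    by (auto simp: star_bounded_def)
  then have "(\<lambda>n. Suc (g n)) \<le>\<^sup>* g" by blast
  then show False
    by (simp add: le_star_def)
qed

lemma bfrak_least: "bfrak \<in> unbounded_cards \<and> (\<forall>s\<in>unbounded_cards. bfrak \<le>o s)"
proof -
  have "unbounded_cards \<noteq> {}"
    using not_star_bounded_UNIV by (auto simp: unbounded_cards_def card_of_Card_order)
  moreover have "\<forall>r\<in>unbounded_cards. Card_order r"
    by (auto simp: unbounded_cards_def card_of_Card_order)
  ultimately have "\<exists>r. r \<in> unbounded_cards \<and> (\<forall>s\<in>unbounded_cards. r \<le>o s)"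
    using exists_minim_Card_order by blast
  then show ?thesis
    unfolding bfrak_def by (rule someI_ex)
qed

end

theory Submission
  imports Defs "HOL-Library.Nat_Bijection"
begin

text \<open>
  Bounding the functions sending \<open>n\<close> to the least element of \<open>y\<close> above \<open>n\<close> by a single \<open>g\<close>, and
  iterating \<open>g\<close>, cuts \<open>\<nat>\<close> into intervals almost all of which meet \<open>y\<close>; this is (1) to (3).
  A partition into finite sets is coarsened to intervals, giving (3) to (2). If almost every interval
  \<open>[g n, g (n + 1))\<close> contains a value of the increasing \<open>f\<close>, counting these values gives
  \<open>f k < g (N + k + 1)\<close>, so that \<open>k \<mapsto> g (2 k + 1)\<close> bounds \<open>f\<close>; this is (2) to (1).
  Finally, a point \<open>x\<close> of an enumerated large cover \<open>U\<close> corresponds to the infinite set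
  \<open>{n. x \<in> U n}\<close>, which translates between (3) and (4).
\<close>

definition admits_partition :: "nat set set \<Rightarrow> bool"
  where "admits_partition Y \<longleftrightarrow>
    (\<exists>F. finite_partition_seq F \<and> (\<forall>y\<in>Y. \<forall>\<^sub>\<infinity>n. y \<inter> F n \<noteq> {}))"

lemma admits_partition_mono: "admits_partition Z \<Longrightarrow> Y \<subseteq> Z \<Longrightarrow> admits_partition Y"
  unfolding admits_partition_def by blast

lemma admits_slalom_mono: "admits_slalom Z \<Longrightarrow> Y \<subseteq> Z \<Longrightarrow> admits_slalom Y"
  unfolding admits_slalom_def by blast

lemma star_bounded_if_card_less_bfrak: "|Y| <o bfrak \<Longrightarrow> star_bounded Y"
  using bfrak_least not_ordLess_ordLeq by (auto simp: unbounded_cards_def)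

section \<open>Interval partitions from a bounding function\<close>

lemma finite_partition_seq_intervals:
  assumes h: "strict_mono h" and h0: "h 0 = 0"
  shows "finite_partition_seq (\<lambda>n. {h n..<h (Suc n)})"
proof -
  have disj: "{h i..<h (Suc i)} \<inter> {h j..<h (Suc j)} = {}" if "i < j" for i j
  proof -
    have "h (Suc i) \<le> h j"
      using that by (simp add: strict_mono_less_eq[OF h])
    then show ?thesis by auto
  qed
  have "\<exists>n. h n \<le> k \<and> k < h (Suc n)" for k
  proof -
    have "k < h (Suc k)"
      using strict_mono_imp_increasing[OF h, of "Suc k"] by simp
    then have *: "k < h (LEAST m. k < h m)"
      by (rule LeastI)
    \<comment> \<open>\<open>h 0 = 0\<close> excludes that the least index is zero; its predecessor
      numbers the interval around \<open>k\<close>.\<close>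
    then obtain n where n: "(LEAST m. k < h m) = Suc n"
      using h0 by (cases "LEAST m. k < h m") auto
    then have "\<not> k < h n"
      by (metis lessI not_less_Least)
    with * n show ?thesis by (intro exI[of _ n]) simp
  qed
  then have un: "(\<Union>n. {h n..<h (Suc n)}) = UNIV" by auto
  have fam: "disjoint_family (\<lambda>n. {h n..<h (Suc n)})"
    unfolding disjoint_family_on_def by (metis disj inf_commute linorder_neqE_nat)
  have ne: "{h n..<h (Suc n)} \<noteq> {}" for n
    using strict_monoD[OF h, of n "Suc n"] by simp
  show ?thesis
    unfolding finite_partition_seq_def partition_on_def
    using un ne disjoint_family_on_disjoint_image[OF fam] fam by auto
qed

lemma admits_partition_if_star_bounded_next:
  assumes inf: "\<And>y. y \<in> Y \<Longrightarrow> infinite y"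
    and bdd: "star_bounded ((\<lambda>y n. LEAST k. k \<in> y \<and> n \<le> k) ` Y)"
  shows "admits_partition Y"
proof -
  obtain g where g: "\<And>y. y \<in> Y \<Longrightarrow> \<forall>\<^sub>\<infinity>n. (LEAST k. k \<in> y \<and> n \<le> k) \<le> g n"
    using bdd by (auto simp: star_bounded_def le_star_def)
  \<comment> \<open>The \<open>max\<close> with \<open>a\<close> forces strict growth where
    \<open>g\<close> is small; the \<open>Suc\<close> puts \<open>g a\<close> inside the half-open
    interval.\<close>
  define h where "h = rec_nat 0 (\<lambda>_ a. Suc (max a (g a)))"
  have h0: "h 0 = 0" and hS: "h (Suc n) = Suc (max (h n) (g (h n)))" for n
    by (simp_all add: h_def)
  have h: "strict_mono h"
    by (simp add: strict_mono_Suc_iff hS less_Suc_eq_le)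
  have "\<forall>\<^sub>\<infinity>n. y \<inter> {h n..<h (Suc n)} \<noteq> {}" if y: "y \<in> Y" for y
  proof -
    obtain N where N: "\<And>n. n \<ge> N \<Longrightarrow> (LEAST k. k \<in> y \<and> n \<le> k) \<le> g n"
      using g[OF y] by (auto simp: MOST_nat_le)
    have "y \<inter> {h n..<h (Suc n)} \<noteq> {}" if n: "n \<ge> N" for n
    proof -
      let ?k = "LEAST k. k \<in> y \<and> h n \<le> k"
      have "\<exists>k. k \<in> y \<and> h n \<le> k"
        using inf[OF y] by (auto simp: infinite_nat_iff_unbounded_le)
      then have "?k \<in> y \<and> h n \<le> ?k"
        by (rule LeastI_ex)
      \<comment> \<open>The bound is applied at \<open>h n\<close>, which is beyond \<open>N\<close>
        because \<open>h n\<close> is at least \<open>n\<close>.\<close>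
      moreover have "?k \<le> g (h n)"
        using N strict_mono_imp_increasing[OF h, of n] n by simp
      ultimately show ?thesis
        by (auto simp: hS intro!: exI[of _ ?k])
    qed
    then show ?thesis by (auto simp: MOST_nat_le)
  qed
  then show ?thesis
    unfolding admits_partition_def using finite_partition_seq_intervals[OF h h0] by blast
qed

lemma admits_partition_if_card_less_bfrak:
  assumes "Y \<subseteq> {y. infinite y}" and "|Y| <o bfrak"
  shows "admits_partition Y"
  using assms(1)
  by (intro admits_partition_if_star_bounded_next star_bounded_if_card_less_bfrak
      ordLeq_ordLess_trans[OF card_of_image assms(2)]) auto

section \<open>From partitions to slaloms\<close>

text \<open>Each number lies in at most one block, so only finitely many blocks meet the numbers
  below \<open>a\<close>.\<close>

lemma finite_partition_seq_avoids:
  assumes F: "finite_partition_seq F"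
  shows "\<exists>k\<ge>n. F k \<subseteq> {a..}"
proof -
  have disj: "F i \<inter> F j = {}" if "i \<noteq> j" for i j
    using F that by (auto simp: finite_partition_seq_def disjoint_family_on_def)
  have "finite {k. b \<in> F k}" for b
  proof (cases "\<exists>i. b \<in> F i")
    case True
    then obtain i where "b \<in> F i" ..
    then have "{k. b \<in> F k} \<subseteq> {i}"
      using disj by blast
    then show ?thesis by (rule finite_subset) simp
  qed simp
  then have "finite (\<Union>b<a. {k. b \<in> F k})"
    by simp
  moreover have "(\<Union>b<a. {k. b \<in> F k}) = {k. F k \<inter> {..<a} \<noteq> {}}"
    by auto
  ultimately have "infinite {k. F k \<inter> {..<a} = {}}"
    using finite_Collect_disjI[of "\<lambda>k. F k \<inter> {..<a} \<noteq> {}" "\<lambda>k. F k \<inter> {..<a} = {}"] by simp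
  then obtain k where "k \<ge> n" "F k \<inter> {..<a} = {}"
    by (auto simp: infinite_nat_iff_unbounded_le)
  then show ?thesis by (intro exI[of _ k]) force
qed

lemma admits_slalom_if_admits_partition:
  assumes "admits_partition (range ` Y)"
  shows "admits_slalom Y"
proof -
  obtain F where F: "finite_partition_seq F"
    and Y: "\<And>f. f \<in> Y \<Longrightarrow> \<forall>\<^sub>\<infinity>n. range f \<inter> F n \<noteq> {}"
    using assms by (auto simp: admits_partition_def)
  obtain K where K: "\<And>n a. K n a \<ge> n" "\<And>n a. F (K n a) \<subseteq> {a..}"
    using finite_partition_seq_avoids[OF F] by metis
  have fin: "finite (F n)" for n
    using F by (simp add: finite_partition_seq_def)
  \<comment> \<open>The interval starting at \<open>a = g n\<close> swallows a whole block above
    \<open>a\<close> whose index is at least \<open>n\<close>. A set meeting almost all blocks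
    therefore meets almost all intervals. Inserting \<open>a\<close> under \<open>Max\<close> gives
    strict growth.\<close>
  define g where "g = rec_nat 0 (\<lambda>n a. Suc (Max (insert a (F (K n a)))))"
  have gS: "g (Suc n) = Suc (Max (insert (g n) (F (K n (g n)))))" for n
    by (simp add: g_def)
  have lt: "a < g (Suc n)" if "a \<in> insert (g n) (F (K n (g n)))" for a n
    unfolding gS less_Suc_eq_le using that fin by (intro Max_ge) auto
  have g: "strict_mono g"
    by (simp add: strict_mono_Suc_iff lt)
  have "\<forall>\<^sub>\<infinity>n. \<exists>m. f m \<in> {g n..<g (Suc n)}" if f: "f \<in> Y" for f
  proof -
    obtain N where N: "\<And>n. n \<ge> N \<Longrightarrow> range f \<inter> F n \<noteq> {}"
      using Y[OF f] by (auto simp: MOST_nat_le)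
    have "\<exists>m. f m \<in> {g n..<g (Suc n)}" if n: "n \<ge> N" for n
    proof -
      obtain m where "f m \<in> F (K n (g n))"
        using N[OF order_trans[OF n K(1)], of "g n"] by auto
      then show ?thesis
        using K(2)[of n "g n"] lt[of "f m" n] by (intro exI[of _ m]) auto
    qed
    then show ?thesis by (auto simp: MOST_nat_le)
  qed
  then show ?thesis
    unfolding admits_slalom_def using g by blast
qed

section \<open>From slaloms to bounded families\<close>

lemma strict_mono_below_slalom:
  fixes f g :: "nat \<Rightarrow> nat"
  assumes f: "strict_mono f" and g: "strict_mono g"
    and N: "\<And>n. n \<ge> N \<Longrightarrow> \<exists>m. f m \<in> {g n..<g (Suc n)}"
  shows "f k < g (N + Suc k)"
proof -
  \<comment> \<open>The intervals numbered \<open>N\<close> to \<open>N + k\<close> supply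
    \<open>k + 1\<close> values of \<open>f\<close>; the induction records this count as an argument
    \<open>m\<close> that is at least \<open>k\<close>.\<close>
  have "\<exists>m\<ge>k. f m < g (N + Suc k)"
  proof (induction k)
    case 0
    then show ?case using N[of N] by auto
  next
    case (Suc k)
    then obtain m where m: "m \<ge> k" "f m < g (N + Suc k)" by blast
    obtain m' where m': "g (N + Suc k) \<le> f m'" "f m' < g (Suc (N + Suc k))"
      using N[of "N + Suc k"] by auto
    have "m < m'"
      using m m' strict_mono_less[OF f] by (metis order_less_le_trans)
    with m m' show ?case by (intro exI[of _ m']) auto
  qed
  then show ?thesis
    using strict_mono_less_eq[OF f] order_le_less_trans by blast
qed

lemma star_bounded_if_admits_slalom:
  assumes Y: "Y \<subseteq> {f. strict_mono f}" and "admits_slalom Y"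
  shows "star_bounded Y"
proof -
  obtain g where g: "strict_mono g"
    and sl: "\<And>f. f \<in> Y \<Longrightarrow> \<forall>\<^sub>\<infinity>n. \<exists>m. f m \<in> {g n..<g (Suc n)}"
    using assms(2) by (auto simp: admits_slalom_def)
  \<comment> \<open>The threshold \<open>N\<close> depends on \<open>f\<close>. Replacing it by
    \<open>k\<close> gives a bound common to all \<open>f\<close>, valid from \<open>N\<close>
    on.\<close>
  have "f \<le>\<^sup>* (\<lambda>k. g (k + Suc k))" if f: "f \<in> Y" for f
  proof -
    obtain N where N: "\<And>n. n \<ge> N \<Longrightarrow> \<exists>m. f m \<in> {g n..<g (Suc n)}"
      using sl[OF f] by (auto simp: MOST_nat_le)
    have "f k \<le> g (k + Suc k)" if "k \<ge> N" for k
    proof -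
      have "f k < g (N + Suc k)"
        using strict_mono_below_slalom[OF _ g N] f Y by blast
      also have "\<dots> \<le> g (k + Suc k)"
        using that by (simp add: strict_mono_less_eq[OF g])
      finally show ?thesis by simp
    qed
    then show ?thesis by (auto simp: le_star_def MOST_nat_le)
  qed
  then show ?thesis unfolding star_bounded_def by blast
qed

text \<open>Partial sums turn an arbitrary family into a strictly increasing one, to which slaloms
  apply, and any bound of the new family bounds the old one.\<close>

definition strict_majorant :: "(nat \<Rightarrow> nat) \<Rightarrow> nat \<Rightarrow> nat"
  where "strict_majorant f n = (\<Sum>i\<le>n. Suc (f i))"

lemma strict_mono_strict_majorant: "strict_mono (strict_majorant f)"
  by (simp add: strict_mono_Suc_iff strict_majorant_def)

lemma le_strict_majorant: "f n \<le> strict_majorant f n"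
  by (cases n) (simp_all add: strict_majorant_def)

lemma inj_strict_majorant: "inj strict_majorant"
proof (rule injI, rule ext)
  fix f f' n
  assume "strict_majorant f = strict_majorant f'"
  then have *: "strict_majorant f n = strict_majorant f' n" for n by simp
  \<comment> \<open>Differences of consecutive partial sums recover the function.\<close>
  show "f n = f' n"
    using *[of n] *[of "n - 1"] by (cases n) (simp_all add: strict_majorant_def)
qed

text \<open>Otherwise an unbounded family of cardinality \<open>bfrak\<close> has at most
  \<open>\<kappa>\<close> members, and so do its strict majorants. A slalom bounds the majorants,
  hence the family itself.\<close>

lemma ordLess_bfrak_if_admits_slalom:
  assumes k: "Card_order \<kappa>"
    and sl: "\<And>Y. Y \<subseteq> {f. strict_mono f} \<Longrightarrow> |Y| \<le>o \<kappa> \<Longrightarrow> admits_slalom Y"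
  shows "\<kappa> <o bfrak"
proof (rule ccontr)
  assume "\<not> \<kappa> <o bfrak"
  obtain Y where Y: "\<not> star_bounded Y" "bfrak = |Y|"
    using bfrak_least by (auto simp: unbounded_cards_def)
  have "|Y| \<le>o \<kappa>"
    using \<open>\<not> \<kappa> <o bfrak\<close> k Y(2) ordLess_or_ordLeq card_of_Well_order card_order_on_well_order_on
    by metis
  then have "|strict_majorant ` Y| \<le>o \<kappa>"
    using card_of_image ordLeq_transitive by blast
  moreover have sm: "strict_majorant ` Y \<subseteq> {f. strict_mono f}"
    using strict_mono_strict_majorant by auto
  ultimately have "star_bounded (strict_majorant ` Y)"
    using sl star_bounded_if_admits_slalom by blast
  then obtain g where g: "\<And>f. f \<in> Y \<Longrightarrow> strict_majorant f \<le>\<^sup>* g"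
    by (auto simp: star_bounded_def)
  have "f \<le>\<^sup>* g" if "f \<in> Y" for f
    using g[OF that] unfolding le_star_def
    by (rule MOST_mono) (rule order_trans[OF le_strict_majorant])
  with Y(1) show False by (auto simp: star_bounded_def)
qed

section \<open>Partitions of the naturals and groupable covers\<close>

lemma groupable_if_admits_partition:
  assumes part: "\<And>Y. Y \<subseteq> {y. infinite y} \<Longrightarrow> |Y| \<le>o |X| \<Longrightarrow> admits_partition Y"
    and "X \<noteq> {}" and "countable \<U>" and U: "large_cover X \<U>"
  shows "groupable X \<U>"
proof -
  \<comment> \<open>A single point of \<open>X\<close> already lies in infinitely many
    members.\<close>
  have "infinite \<U>"
    using U \<open>X \<noteq> {}\<close> by (auto simp: large_cover_def dest: finite_subset)
  then obtain u :: "nat \<Rightarrow> 'a set" where u: "bij_betw u UNIV \<U>"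
    using \<open>countable \<U>\<close> bij_betw_from_nat_into by blast
  then have inj: "inj u" and ran: "range u = \<U>"
    by (auto simp: bij_betw_def)
  let ?y = "\<lambda>x. {n. x \<in> u n}"
  have "infinite (?y x)" if "x \<in> X" for x
  proof -
    have "u ` ?y x = {V \<in> \<U>. x \<in> V}" using ran by auto
    moreover have "infinite {V \<in> \<U>. x \<in> V}"
      using U that by (auto simp: large_cover_def)
    ultimately show ?thesis by (metis finite_imageI)
  qed
  then have "admits_partition (?y ` X)"
    by (intro part) (auto simp: card_of_image)
  then obtain F where F: "finite_partition_seq F"
    and hit: "\<And>x. x \<in> X \<Longrightarrow> \<forall>\<^sub>\<infinity>n. ?y x \<inter> F n \<noteq> {}"
    by (auto simp: admits_partition_def)
  let ?P = "(\<lambda>n. u ` F n) ` UNIV"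
  have "partition_on UNIV (range F)"
    using F by (simp add: finite_partition_seq_def)
  then have "partition_on (range u) ((`) u ` range F - {{}})"
    using inj by (rule partition_on_inj_image)
  \<comment> \<open>Blocks are nonempty, so removing the empty set changes nothing.\<close>
  moreover have "(`) u ` range F - {{}} = ?P"
    using F by (auto simp: finite_partition_seq_def partition_on_def)
  ultimately have "partition_on \<U> ?P"
    by (simp only: ran)
  moreover have "\<forall>G\<in>?P. finite G"
    using F by (auto simp: finite_partition_seq_def)
  moreover have "finite {G \<in> ?P. x \<notin> \<Union>G}" if "x \<in> X" for x
  proof (rule finite_subset)
    show "{G \<in> ?P. x \<notin> \<Union>G} \<subseteq> (\<lambda>n. u ` F n) ` {n. \<not> ?y x \<inter> F n \<noteq> {}}" by auto
    show "finite ((\<lambda>n. u ` F n) ` {n. \<not> ?y x \<inter> F n \<noteq> {}})"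
      using hit[OF that] unfolding MOST_iff_cofinite by (rule finite_imageI)
  qed
  ultimately show ?thesis unfolding groupable_def by blast
qed

text \<open>The sets \<open>- {n}\<close> in the family make the members of the cover below distinct.\<close>

lemma admits_partition_if_groupable_aux:
  fixes y :: "'a \<Rightarrow> nat set"
  assumes grp: "\<And>\<U>. countable \<U> \<Longrightarrow> large_cover X \<U> \<Longrightarrow> groupable X \<U>"
    and inf: "\<And>x. x \<in> X \<Longrightarrow> infinite (y x)"
    and sep: "\<And>n. - {n} \<in> y ` X"
  shows "admits_partition (y ` X)"
proof -
  \<comment> \<open>The dual incidence: for \<open>x\<close> in \<open>X\<close>, the set
    \<open>y x\<close> consists of the indices of the members containing \<open>x\<close>.\<close>
  define u where "u n = {x \<in> X. n \<in> y x}" for n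
  have inj: "inj u"
  proof (rule injI)
    fix m n
    assume eq: "u m = u n"
    obtain x where "x \<in> X" "y x = - {n}"
      using sep[of n] by auto
    then have "x \<notin> u n" and "m \<noteq> n \<Longrightarrow> x \<in> u m"
      by (auto simp: u_def)
    with eq show "m = n" by auto
  qed
  have "infinite {V \<in> range u. x \<in> V}" if "x \<in> X" for x
  proof -
    have "{V \<in> range u. x \<in> V} = u ` y x" using that by (auto simp: u_def)
    with inf[OF that] inj show ?thesis
      by (simp add: finite_image_iff inj_on_subset)
  qed
  then have "large_cover X (range u)"
    by (auto simp: large_cover_def u_def)
  then have "groupable X (range u)"
    by (intro grp) auto
  then obtain P where P: "partition_on (range u) P" "\<And>G. G \<in> P \<Longrightarrow> finite G"
    and hit: "\<And>x. x \<in> X \<Longrightarrow> finite {G \<in> P. x \<notin> \<Union>G}"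
    unfolding groupable_def by blast
  have UP: "\<Union>P = range u"
    using P(1) by (simp add: partition_on_def)
  \<comment> \<open>A \<open>finite_partition_seq\<close> needs disjoint nonempty blocks indexed by
    all naturals, so \<open>P\<close> must be countably infinite.\<close>
  have "infinite P"
    using P(2) UP finite_Union[of P] range_inj_infinite[OF inj] by auto
  moreover have "countable P"
  proof -
    have "P \<subseteq> {G. finite G \<and> G \<subseteq> range u}"
      using P(2) UP by auto
    then show ?thesis
      using countable_Collect_finite_subset[of "range u"] countable_subset by blast
  qed
  ultimately obtain p :: "nat \<Rightarrow> 'a set set" where p: "bij_betw p UNIV P"
    using bij_betw_from_nat_into by blast
  then have pP: "range p = P" and pinj: "inj p" by (auto simp: bij_betw_def)
  define F where "F n = u -` p n" for n
  have ne: "F n \<noteq> {}" for n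
  proof -
    have "p n \<in> P" using pP by auto
    then have "p n \<noteq> {}" "p n \<subseteq> range u"
      using P(1) by (auto simp: partition_on_def)
    then show ?thesis by (auto simp: F_def)
  qed
  have disj: "F m \<inter> F n = {}" if "m \<noteq> n" for m n
  proof -
    have "p m \<in> P" "p n \<in> P" "p m \<noteq> p n"
      using pP pinj that by (auto dest: injD)
    then have "p m \<inter> p n = {}"
      using P(1) by (auto simp: partition_on_def dest: disjointD)
    then show ?thesis by (auto simp: F_def)
  qed
  have "(\<Union>n. F n) = UNIV"
  proof -
    have "\<exists>n. k \<in> F n" for k
    proof -
      have "u k \<in> \<Union>P" unfolding UP by blast
      then show ?thesis unfolding pP[symmetric] by (auto simp: F_def)
    qed
    then show ?thesis by auto
  qed
  moreover have "finite (F n)" for n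
    unfolding F_def using P(2) pP inj by (intro finite_vimageI) auto
  moreover have fam: "disjoint_family F"
    using disj by (auto simp: disjoint_family_on_def)
  ultimately have "finite_partition_seq F"
    unfolding finite_partition_seq_def partition_on_def
    using ne disjoint_family_on_disjoint_image[OF fam] by auto
  moreover have "\<forall>\<^sub>\<infinity>n. y x \<inter> F n \<noteq> {}" if "x \<in> X" for x
  proof -
    \<comment> \<open>If \<open>y x\<close> misses \<open>F n\<close>, no member of the group
      \<open>p n\<close> contains \<open>x\<close>. Only finitely many groups do this, and
      injectivity of \<open>p\<close> carries finiteness back to the indices.\<close>
    have "p ` {n. \<not> y x \<inter> F n \<noteq> {}} \<subseteq> {G \<in> P. x \<notin> \<Union>G}"
    proof clarsimp
      fix n
      assume "y x \<inter> F n = {}"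
      moreover have "p n \<in> P" using pP by auto
      moreover from this have "p n \<subseteq> range u" using UP by auto
      ultimately show "p n \<in> P \<and> (\<forall>V\<in>p n. x \<notin> V)"
        by (fastforce simp: F_def u_def)
    qed
    then have "finite (p ` {n. \<not> y x \<inter> F n \<noteq> {}})"
      using hit[OF that] finite_subset by blast
    then show ?thesis
      unfolding MOST_iff_cofinite using pinj by (simp add: finite_image_iff inj_on_subset)
  qed
  ultimately show ?thesis unfolding admits_partition_def by blast
qed

text \<open>Adding the countably many complements of singletons to \<open>Y\<close> keeps the
  cardinality at most that of the infinite set \<open>X\<close>, so \<open>X\<close> can index the
  enlarged family, possibly with repetitions.\<close>

lemma admits_partition_if_groupable:
  assumes grp: "\<And>\<U>. countable \<U> \<Longrightarrow> large_cover X \<U> \<Longrightarrow> groupable X \<U>"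
    and X: "infinite X" and Y: "Y \<subseteq> {y. infinite y}" "|Y| \<le>o |X|"
  shows "admits_partition Y"
proof -
  let ?Z = "Y \<union> range (\<lambda>n. - {n})"
  have "|range (\<lambda>n::nat. - {n})| \<le>o |X|"
    using card_of_image[of "\<lambda>n::nat. - {n}" UNIV] X infinite_iff_card_of_nat ordLeq_transitive
    by blast
  then have "|?Z| \<le>o |X|"
    using X Y(2) by (intro card_of_Un_ordLeq_infinite_Field[OF _ _ _ card_of_Card_order])
      (simp_all add: Field_card_of)
  moreover have "?Z \<noteq> {}" by simp
  ultimately obtain y where y: "y ` X = ?Z"
    using card_of_ordLeq2 by metis
  have "infinite (- {n})" for n :: nat
    by (simp add: finite_compl)
  then have "infinite (y x)" if "x \<in> X" for x
    using y that Y(1) by (metis (no_types, lifting) UnE imageI mem_Collect_eq rangeE subsetD)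
  then have "admits_partition (y ` X)"
    by (intro admits_partition_if_groupable_aux grp) (auto simp: y)
  then show ?thesis
    by (rule admits_partition_mono) (simp add: y)
qed

section \<open>Families of cardinality exactly or at most \<open>\<kappa>\<close>\<close>

text \<open>A smaller \<open>Y\<close> is padded with a copy of \<open>Field \<kappa>\<close> inside
  \<open>A\<close>; the union has cardinality exactly \<open>\<kappa>\<close>, and \<open>Q\<close>
  passes to subsets.\<close>

lemma all_subsets_card_eq_iff_card_le:
  assumes k: "Card_order \<kappa>" "infinite (Field \<kappa>)" "\<kappa> \<le>o |A|"
    and mono: "\<And>Y Z. Q Z \<Longrightarrow> Y \<subseteq> Z \<Longrightarrow> Q Y"
  shows "(\<forall>Y\<subseteq>A. |Y| =o \<kappa> \<longrightarrow> Q Y) \<longleftrightarrow> (\<forall>Y\<subseteq>A. |Y| \<le>o \<kappa> \<longrightarrow> Q Y)"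
proof (intro iffI allI impI)
  fix Y
  assume eq: "\<forall>Y\<subseteq>A. |Y| =o \<kappa> \<longrightarrow> Q Y" and Y: "Y \<subseteq> A" "|Y| \<le>o \<kappa>"
  have "|Field \<kappa>| =o \<kappa>"
    using k(1) by (rule card_of_Field_ordIso)
  moreover then obtain i where i: "inj_on i (Field \<kappa>)" "i ` Field \<kappa> \<subseteq> A"
    using ordIso_ordLeq_trans[OF _ k(3)] card_of_ordLeq by metis
  ultimately have Z: "|i ` Field \<kappa>| =o \<kappa>"
    using card_of_ordIso[THEN iffD1, OF exI, OF inj_on_imp_bij_betw, THEN ordIso_symmetric]
      ordIso_transitive by blast
  have "|Y \<union> i ` Field \<kappa>| \<le>o \<kappa>"
    using card_of_Un_ordLeq_infinite_Field[OF k(2) Y(2) ordIso_imp_ordLeq[OF Z] k(1)] .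
  moreover have "\<kappa> \<le>o |Y \<union> i ` Field \<kappa>|"
    using Z card_of_mono1[of "i ` Field \<kappa>" "Y \<union> i ` Field \<kappa>"] ordIso_ordLeq_trans ordIso_symmetric
    by blast
  ultimately have "|Y \<union> i ` Field \<kappa>| =o \<kappa>"
    by (simp add: ordIso_iff_ordLeq)
  with eq Y i have "Q (Y \<union> i ` Field \<kappa>)" by simp
  then show "Q Y" by (rule mono) simp
qed (use ordIso_imp_ordLeq in blast)

lemma card_of_strict_mono_ge: "|UNIV :: (nat \<Rightarrow> nat) set| \<le>o |{f :: nat \<Rightarrow> nat. strict_mono f}|"
  using inj_strict_majorant strict_mono_strict_majorant
  by (intro card_of_ordLeq[THEN iffD1] exI[of _ strict_majorant]) auto

text \<open>The coded graph of a function is an infinite set of naturals and determines the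
  function.\<close>

lemma card_of_infinite_ge: "|UNIV :: (nat \<Rightarrow> nat) set| \<le>o |{y :: nat set. infinite y}|"
proof -
  let ?graph = "\<lambda>f :: nat \<Rightarrow> nat. range (\<lambda>n. prod_encode (n, f n))"
  have "infinite (?graph f)" for f
    by (rule range_inj_infinite) (auto intro: injI)
  moreover have "inj ?graph"
  proof (rule injI, rule ext)
    fix f f' n
    assume "?graph f = ?graph f'"
    then have "prod_encode (n, f n) \<in> ?graph f'" by blast
    then show "f n = f' n" by auto
  qed
  ultimately show ?thesis
    by (intro card_of_ordLeq[THEN iffD1] exI[of _ ?graph]) auto
qed

text \<open>The conditions on families of cardinality exactly \<open>\<kappa>\<close> are restricted
  to \<open>\<kappa>\<close> at most the continuum: above it they hold vacuously, while
  \<open>\<kappa> <o bfrak\<close> fails. With "at most \<open>\<kappa>\<close>" the equivalences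
  hold for every infinite cardinal.\<close>

theorem corollary8:
  fixes \<kappa> :: "'k rel"
  assumes "Card_order \<kappa>" and "infinite (Field \<kappa>)"
  shows
    "(\<kappa> \<le>o |UNIV :: (nat \<Rightarrow> nat) set| \<longrightarrow>
        (\<kappa> <o bfrak \<longleftrightarrow>
          (\<forall>Y \<subseteq> {f. strict_mono f}. |Y| =o \<kappa> \<longrightarrow> admits_slalom Y)) \<and>
        (\<kappa> <o bfrak \<longleftrightarrow>
          (\<forall>Y \<subseteq> {y. infinite y}. |Y| =o \<kappa> \<longrightarrow>
            (\<exists>F. finite_partition_seq F \<and> (\<forall>y\<in>Y. \<forall>\<^sub>\<infinity>n. y \<inter> F n \<noteq> {}))))) \<and>
     (\<kappa> <o bfrak \<longleftrightarrow>
       (\<forall>Y \<subseteq> {f. strict_mono f}. |Y| \<le>o \<kappa> \<longrightarrow> admits_slalom Y)) \<and>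
     (\<kappa> <o bfrak \<longleftrightarrow>
       (\<forall>Y \<subseteq> {y. infinite y}. |Y| \<le>o \<kappa> \<longrightarrow>
         (\<exists>F. finite_partition_seq F \<and> (\<forall>y\<in>Y. \<forall>\<^sub>\<infinity>n. y \<inter> F n \<noteq> {})))) \<and>
     (\<kappa> <o bfrak \<longleftrightarrow>
       (\<forall>\<U>. countable \<U> \<and> large_cover (Field \<kappa>) \<U> \<longrightarrow> groupable (Field \<kappa>) \<U>))"
proof -
  let ?slalom = "\<forall>Y \<subseteq> {f. strict_mono f}. |Y| \<le>o \<kappa> \<longrightarrow> admits_slalom Y"
  let ?part = "\<forall>Y \<subseteq> {y. infinite y}. |Y| \<le>o \<kappa> \<longrightarrow> admits_partition Y"
  let ?group = "\<forall>\<U>. countable \<U> \<and> large_cover (Field \<kappa>) \<U> \<longrightarrow> groupable (Field \<kappa>) \<U>"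
  have k: "|Field \<kappa>| =o \<kappa>"
    using assms(1) by (rule card_of_Field_ordIso)
  have le_iff: "|Y| \<le>o |Field \<kappa>| \<longleftrightarrow> |Y| \<le>o \<kappa>" for Y :: "nat set set"
    using k ordIso_symmetric ordLeq_ordIso_trans by blast
  \<comment> \<open>Digits in the fact names give source and target: 1 is
    \<open>\<kappa> <o bfrak\<close>, 2 \<open>?slalom\<close>, 3 \<open>?part\<close>, 4
    \<open>?group\<close>. The cycle 1, 3, 2, 1 together with \<open>34\<close> and
    \<open>43\<close> yields every equivalence.\<close>
  have 13: "?part" if "\<kappa> <o bfrak"
    using that admits_partition_if_card_less_bfrak ordLeq_ordLess_trans by blast
  have 32: "?slalom" if part: "?part"
  proof (intro allI impI)
    fix Y :: "(nat \<Rightarrow> nat) set"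
    assume Y: "Y \<subseteq> {f. strict_mono f}" "|Y| \<le>o \<kappa>"
    have "range ` Y \<subseteq> {y. infinite y}"
      using Y(1) by (auto dest!: strict_mono_imp_inj_on range_inj_infinite)
    moreover have "|range ` Y| \<le>o \<kappa>"
      using card_of_image Y(2) ordLeq_transitive by blast
    ultimately show "admits_slalom Y"
      using part by (intro admits_slalom_if_admits_partition) blast
  qed
  have 21: "\<kappa> <o bfrak" if "?slalom"
    using that by (intro ordLess_bfrak_if_admits_slalom assms(1)) blast
  have 34: "?group" if "?part"
  proof (intro allI impI, elim conjE)
    fix \<U>
    assume "countable \<U>" "large_cover (Field \<kappa>) \<U>"
    then show "groupable (Field \<kappa>) \<U>"
      using that assms(2) le_iff by (intro groupable_if_admits_partition) auto
  qed
  have 43: "?part" if "?group"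
    using that admits_partition_if_groupable[of "Field \<kappa>"] assms(2) le_iff by auto
  have slalom: "\<kappa> <o bfrak \<longleftrightarrow> ?slalom" and part: "\<kappa> <o bfrak \<longleftrightarrow> ?part"
    and group: "\<kappa> <o bfrak \<longleftrightarrow> ?group"
    using 13 32 21 34 43 by argo+
  have slalom_eq: "(\<forall>Y \<subseteq> {f. strict_mono f}. |Y| =o \<kappa> \<longrightarrow> admits_slalom Y) \<longleftrightarrow> ?slalom"
    if "\<kappa> \<le>o |UNIV :: (nat \<Rightarrow> nat) set|"
    using ordLeq_transitive[OF that card_of_strict_mono_ge] admits_slalom_mono
    by (rule all_subsets_card_eq_iff_card_le[OF assms])
  have part_eq: "(\<forall>Y \<subseteq> {y. infinite y}. |Y| =o \<kappa> \<longrightarrow> admits_partition Y) \<longleftrightarrow> ?part"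
    if "\<kappa> \<le>o |UNIV :: (nat \<Rightarrow> nat) set|"
    using ordLeq_transitive[OF that card_of_infinite_ge] admits_partition_mono
    by (rule all_subsets_card_eq_iff_card_le[OF assms])
  show ?thesis
    unfolding admits_partition_def[symmetric]
    using slalom part group slalom_eq part_eq by argo
qed

end
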